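(* Let $X=L^2(0,1)$ be the space of square integrable Lebesgue measurable complex-valued functions on $(0,1)$ and $Y=\mathbb C$. Let $A\in\mathcal L(X)$ and $C\in\mathcal L(X,Y)$ be given by $$(Af)(s)=is\,f(s),\ s\in(0,1),\qquad Cf=\int_0^1f(s)\,\mathrm ds.$$ Consider the system $\dot x(t)=Ax(t)$, $y(t)=Cx(t)$. Then: (i) the system is exponentially zero-detectable; (ii) the system is not eOSS.
   Context: $\mathcal L(X,Y)$ denotes the bounded linear operators from $X$ to $Y$, $\mathcal L(X)=\mathcal L(X,X)$. $A$ generates the $C_0$-group $(T(t)f)(s)=e^{ist}f(s)$. The mild solution with initial state $x\in X$ is $\phi(t,x)=T(t)x$ and the output trajectory is $y(t,x)=CT(t)x$, $t\ge0$. $\mathcal K$ is the set of continuous strictly increasing $\gamma:[0,\infty)\to[0,\infty)$ with $\gamma(0)=0$. Exponentially zero-detectable: there exist $M,\omega>0$ such that for all $x\in X$: $y(\cdot,x)\equiv0$ implies $\|\phi(t,x)\|_X\le Me^{-\omega t}\|x\|_X$ for all $t\ge0$. eOSS (exponentially output-to-state stable): there exist $M,\mu>0$ and $\gamma\in\mathcal K$ such that for all $x\in X$, $t\ge0$: $\|\phi(t,x)\|_X\le Me^{-\mu t}\|x\|_X+\gamma\bigl(\max_{s\in[0,t]}\|y(s,x)\|_Y\bigr)$. *)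

theory Defs
  imports "HOL-Analysis.Analysis"
begin

section \<open>The space \<open>L\<^sup>2(0,1)\<close> of complex-valued functions\<close>

abbreviation leb01 :: "real measure" where
  "leb01 \<equiv> lebesgue_on {0<..<1}"

definition sq_int :: "(real \<Rightarrow> complex) \<Rightarrow> bool" where
  "sq_int f \<longleftrightarrow> f \<in> borel_measurable leb01 \<and> integrable leb01 (\<lambda>s. (cmod (f s))\<^sup>2)"

lemma sq_int_measurable [measurable_dest]: "sq_int f \<Longrightarrow> f \<in> borel_measurable leb01"
  by (simp add: sq_int_def)

lemma sq_int_integrable: "sq_int f \<Longrightarrow> integrable leb01 (\<lambda>s. (cmod (f s))\<^sup>2)"
  by (simp add: sq_int_def)

lemma sq_int_const [simp]: "sq_int (\<lambda>_. c)"
  by (simp add: sq_int_def finite_measure.integrable_const finite_measure_lebesgue_on)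

lemma sq_int_bounded_mult:
  assumes f: "sq_int f" and m: "m \<in> borel_measurable leb01"
    and b: "\<And>s. 0 < s \<Longrightarrow> s < 1 \<Longrightarrow> cmod (m s) \<le> B"
  shows "sq_int (\<lambda>s. m s * f s)"
proof -
  note [measurable] = m sq_int_measurable[OF f]
  have "integrable leb01 (\<lambda>s. B\<^sup>2 * (cmod (f s))\<^sup>2)"
    using sq_int_integrable[OF f] by simp
  moreover have "AE s in leb01. norm ((cmod (m s * f s))\<^sup>2) \<le> norm (B\<^sup>2 * (cmod (f s))\<^sup>2)"
    by (rule AE_I2) (auto simp: norm_mult power_mult_distrib intro!: mult_right_mono power_mono b)
  ultimately have "integrable leb01 (\<lambda>s. (cmod (m s * f s))\<^sup>2)"
    by (intro Bochner_Integration.integrable_bound[where g = "\<lambda>s. (cmod (m s * f s))\<^sup>2"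
          and f = "\<lambda>s. B\<^sup>2 * (cmod (f s))\<^sup>2"]) measurable
  thus ?thesis by (simp add: sq_int_def)
qed

lemma sq_int_cmult: "sq_int f \<Longrightarrow> sq_int (\<lambda>s. c * f s)"
  by (rule sq_int_bounded_mult[where B = "cmod c"]) auto

lemma sq_int_add:
  assumes f: "sq_int f" and g: "sq_int g"
  shows "sq_int (\<lambda>s. f s + g s)"
proof -
  note [measurable] = sq_int_measurable[OF f] sq_int_measurable[OF g]
  have *: "(cmod (a + b))\<^sup>2 \<le> 2 * (cmod a)\<^sup>2 + 2 * (cmod b)\<^sup>2" for a b
  proof -
    have "(cmod (a + b))\<^sup>2 \<le> (cmod a + cmod b)\<^sup>2"
      by (intro power_mono norm_triangle_ineq) auto
    also have "\<dots> \<le> 2 * (cmod a)\<^sup>2 + 2 * (cmod b)\<^sup>2"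
      using sum_squares_bound[of "cmod a" "cmod b"] by (simp add: power2_sum)
    finally show ?thesis .
  qed
  have "integrable leb01 (\<lambda>s. 2 * (cmod (f s))\<^sup>2 + 2 * (cmod (g s))\<^sup>2)"
    using sq_int_integrable[OF f] sq_int_integrable[OF g] by simp
  moreover have "AE s in leb01. norm ((cmod (f s + g s))\<^sup>2)
      \<le> norm (2 * (cmod (f s))\<^sup>2 + 2 * (cmod (g s))\<^sup>2)"
    by (rule AE_I2) (use * in simp)
  ultimately have "integrable leb01 (\<lambda>s. (cmod (f s + g s))\<^sup>2)"
    by (intro Bochner_Integration.integrable_bound[where g = "\<lambda>s. (cmod (f s + g s))\<^sup>2"
          and f = "\<lambda>s. 2 * (cmod (f s))\<^sup>2 + 2 * (cmod (g s))\<^sup>2"]) measurable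
  thus ?thesis by (simp add: sq_int_def)
qed

lemma sq_int_uminus: "sq_int f \<Longrightarrow> sq_int (\<lambda>s. - f s)"
  using sq_int_cmult[of f "-1"] by simp

lemma sq_int_diff: "sq_int f \<Longrightarrow> sq_int g \<Longrightarrow> sq_int (\<lambda>s. f s - g s)"
  using sq_int_add[of f "\<lambda>s. - g s"] sq_int_uminus[of g] by simp

lemma sq_int_inner_integrable:
  assumes f: "sq_int f" and g: "sq_int g"
  shows "integrable leb01 (\<lambda>s. f s * cnj (g s))"
proof -
  note [measurable] = sq_int_measurable[OF f] sq_int_measurable[OF g]
  have m: "(\<lambda>s. f s * cnj (g s)) \<in> borel_measurable leb01"
    by (intro borel_measurable_times borel_measurable_continuous_onI
          measurable_compose[OF sq_int_measurable[OF g], of cnj borel] sq_int_measurable[OF f])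
       (auto intro!: continuous_intros)
  have "integrable leb01 (\<lambda>s. (cmod (f s))\<^sup>2 + (cmod (g s))\<^sup>2)"
    using sq_int_integrable[OF f] sq_int_integrable[OF g] by simp
  moreover have "AE s in leb01. norm (f s * cnj (g s)) \<le> norm ((cmod (f s))\<^sup>2 + (cmod (g s))\<^sup>2)"
  proof (rule AE_I2)
    fix s
    have "2 * (cmod (f s) * cmod (g s)) \<le> (cmod (f s))\<^sup>2 + (cmod (g s))\<^sup>2"
      using sum_squares_bound[of "cmod (f s)" "cmod (g s)"] by simp
    moreover have "0 \<le> cmod (f s) * cmod (g s)" by simp
    ultimately have "cmod (f s) * cmod (g s) \<le> (cmod (f s))\<^sup>2 + (cmod (g s))\<^sup>2" by linarith
    thus "norm (f s * cnj (g s)) \<le> norm ((cmod (f s))\<^sup>2 + (cmod (g s))\<^sup>2)"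
      by (simp add: norm_mult)
  qed
  ultimately show ?thesis
    by (intro Bochner_Integration.integrable_bound[OF _ m])
qed

lemma sq_int_imp_integrable: "sq_int f \<Longrightarrow> integrable leb01 f"
  using sq_int_inner_integrable[of f "\<lambda>_. 1"] by simp

quotient_type L2 = "real \<Rightarrow> complex" / partial:
    "\<lambda>f g. sq_int f \<and> sq_int g \<and> (AE s in leb01. f s = g s)"
proof (rule part_equivpI)
  show "\<exists>f. sq_int f \<and> sq_int f \<and> (AE s in leb01. f s = f s)"
    by (rule exI[of _ "\<lambda>_. 0"]) simp
  show "symp (\<lambda>f g. sq_int f \<and> sq_int g \<and> (AE s in leb01. f s = g s))"
    by (auto simp: symp_def elim: AE_mp)
  show "transp (\<lambda>f g. sq_int f \<and> sq_int g \<and> (AE s in leb01. f s = g s))"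
    unfolding transp_def by (auto elim: AE_mp)
qed

instantiation L2 :: real_inner
begin

lift_definition zero_L2 :: L2 is "\<lambda>_. 0" by simp

lift_definition plus_L2 :: "L2 \<Rightarrow> L2 \<Rightarrow> L2" is "\<lambda>f g s. f s + g s"
  by (auto intro: sq_int_add elim: eventually_elim2)

lift_definition minus_L2 :: "L2 \<Rightarrow> L2 \<Rightarrow> L2" is "\<lambda>f g s. f s - g s"
  by (auto intro: sq_int_diff elim: eventually_elim2)

lift_definition uminus_L2 :: "L2 \<Rightarrow> L2" is "\<lambda>f s. - f s"
  by (auto intro: sq_int_uminus)

lift_definition scaleR_L2 :: "real \<Rightarrow> L2 \<Rightarrow> L2" is "\<lambda>r f s. complex_of_real r * f s"
  by (auto intro: sq_int_cmult)

lift_definition norm_L2 :: "L2 \<Rightarrow> real" is "\<lambda>f. sqrt (\<integral>s. (cmod (f s))\<^sup>2 \<partial>leb01)"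
proof -
  fix f g :: "real \<Rightarrow> complex"
  assume *: "sq_int f \<and> sq_int g \<and> (AE s in leb01. f s = g s)"
  have "(\<integral>s. (cmod (f s))\<^sup>2 \<partial>leb01) = (\<integral>s. (cmod (g s))\<^sup>2 \<partial>leb01)"
    using * by (intro integral_cong_AE borel_measurable_integrable sq_int_integrable) auto
  thus "sqrt (\<integral>s. (cmod (f s))\<^sup>2 \<partial>leb01) = sqrt (\<integral>s. (cmod (g s))\<^sup>2 \<partial>leb01)"
    by simp
qed

text \<open>The real part of the usual complex inner product.\<close>

lift_definition inner_L2 :: "L2 \<Rightarrow> L2 \<Rightarrow> real" is "\<lambda>f g. Re (\<integral>s. f s * cnj (g s) \<partial>leb01)"
proof -
  fix f f' g g' :: "real \<Rightarrow> complex"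
  assume f: "sq_int f \<and> sq_int f' \<and> (AE s in leb01. f s = f' s)"
    and g: "sq_int g \<and> sq_int g' \<and> (AE s in leb01. g s = g' s)"
  have "AE s in leb01. f s * cnj (g s) = f' s * cnj (g' s)"
    using f g by (auto elim: eventually_elim2)
  hence "(\<integral>s. f s * cnj (g s) \<partial>leb01) = (\<integral>s. f' s * cnj (g' s) \<partial>leb01)"
    using f g by (intro integral_cong_AE borel_measurable_integrable sq_int_inner_integrable) auto
  thus "Re (\<integral>s. f s * cnj (g s) \<partial>leb01) = Re (\<integral>s. f' s * cnj (g' s) \<partial>leb01)"
    by simp
qed

definition dist_L2 :: "L2 \<Rightarrow> L2 \<Rightarrow> real" where
  "dist_L2 x y = norm (x - y)"

definition sgn_L2 :: "L2 \<Rightarrow> L2" where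
  "sgn_L2 x = inverse (norm x) *\<^sub>R x"

definition uniformity_L2 :: "(L2 \<times> L2) filter" where
  "uniformity_L2 = (INF e\<in>{0<..}. principal {(x, y). dist x y < e})"

definition open_L2 :: "L2 set \<Rightarrow> bool" where
  "open_L2 U \<longleftrightarrow> (\<forall>x\<in>U. \<forall>\<^sub>F (x', y) in uniformity. x' = x \<longrightarrow> y \<in> U)"

instance
proof
  fix x y z :: L2 and a b r :: real and U :: "L2 set"
  show "x + y + z = x + (y + z)"
    by transfer (auto simp: add.assoc intro!: sq_int_add)
  show "x + y = y + x"
    by transfer (auto simp: add.commute intro!: sq_int_add)
  show "0 + x = x" by transfer auto
  show "- x + x = 0" by transfer auto
  show "x - y = x + - y"
    by transfer (auto intro!: sq_int_diff sq_int_add sq_int_uminus)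
  show "a *\<^sub>R (x + y) = a *\<^sub>R x + a *\<^sub>R y"
    by transfer (auto simp: distrib_left intro!: sq_int_add sq_int_cmult)
  show "(a + b) *\<^sub>R x = a *\<^sub>R x + b *\<^sub>R x"
    by transfer (auto simp: distrib_right intro!: sq_int_add sq_int_cmult)
  show "a *\<^sub>R b *\<^sub>R x = (a * b) *\<^sub>R x"
    by transfer (auto intro!: sq_int_cmult)
  show "1 *\<^sub>R x = x" by transfer auto
  show "sgn x = inverse (norm x) *\<^sub>R x" by (simp add: sgn_L2_def)
  show "dist x y = norm (x - y)" by (simp add: dist_L2_def)
  show "uniformity = (INF e\<in>{0<..}. principal {(x::L2, y). dist x y < e})"
    by (simp add: uniformity_L2_def)
  show "open U = (\<forall>x\<in>U. \<forall>\<^sub>F (x', y) in uniformity. x' = x \<longrightarrow> y \<in> U)"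
    by (simp add: open_L2_def)
  show "inner x y = inner y x"
  proof transfer
    fix f g :: "real \<Rightarrow> complex"
    have "cnj (\<integral>s. f s * cnj (g s) \<partial>leb01) = (\<integral>s. cnj (f s * cnj (g s)) \<partial>leb01)"
      by (rule Bochner_Integration.integral_cnj[symmetric])
    also have "\<dots> = (\<integral>s. g s * cnj (f s) \<partial>leb01)" by (simp add: mult.commute)
    finally show "Re (\<integral>s. f s * cnj (g s) \<partial>leb01) = Re (\<integral>s. g s * cnj (f s) \<partial>leb01)"
      by (metis cnj.simps(1))
  qed
  show "inner (x + y) z = inner x z + inner y z"
    by transfer (simp add: distrib_right Bochner_Integration.integral_add sq_int_inner_integrable)
  show "inner (r *\<^sub>R x) y = r * inner x y"
    by transfer (simp add: mult.assoc)
  have ii: "inner x x = (norm x)\<^sup>2" for x :: L2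
  proof transfer
    fix f :: "real \<Rightarrow> complex"
    have "(\<integral>s. f s * cnj (f s) \<partial>leb01) = (\<integral>s. complex_of_real ((cmod (f s))\<^sup>2) \<partial>leb01)"
      by (simp only: complex_norm_square)
    also have "\<dots> = complex_of_real (\<integral>s. (cmod (f s))\<^sup>2 \<partial>leb01)"
      by (rule integral_complex_of_real)
    finally show "Re (\<integral>s. f s * cnj (f s) \<partial>leb01) = (sqrt (\<integral>s. (cmod (f s))\<^sup>2 \<partial>leb01))\<^sup>2"
      by (simp add: integral_nonneg_AE)
  qed
  have nn: "0 \<le> norm x" by transfer (simp add: integral_nonneg_AE)
  show "0 \<le> inner x x" by (simp add: ii)
  show "norm x = sqrt (inner x x)" using nn by (simp add: ii)
  have "norm x = 0 \<longleftrightarrow> x = 0"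
  proof transfer
    fix f :: "real \<Rightarrow> complex"
    assume "sq_int f \<and> sq_int f \<and> (AE s in leb01. f s = f s)"
    hence f: "sq_int f" by simp
    show "sqrt (\<integral>s. (cmod (f s))\<^sup>2 \<partial>leb01) = 0 \<longleftrightarrow>
        sq_int f \<and> sq_int (\<lambda>_. 0) \<and> (AE s in leb01. f s = 0)"
      using integral_nonneg_eq_0_iff_AE[OF sq_int_integrable[OF f]] f by simp
  qed
  thus "inner x x = 0 \<longleftrightarrow> x = 0" by (simp add: ii)
qed

end

text \<open>The complex vector space structure. Morphisms of type \<open>_ \<Rightarrow>\<^sub>L _\<close> are only
  real-linear by type; complex linearity of the concrete operators is recorded below.\<close>

lift_definition scaleC_L2 :: "complex \<Rightarrow> L2 \<Rightarrow> L2" is "\<lambda>c f s. c * f s"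
  by (auto intro: sq_int_cmult)

section \<open>The operators \<open>A\<close>, \<open>C\<close> and \<open>T(t)\<close>\<close>

lemma sq_int_A: "sq_int f \<Longrightarrow> sq_int (\<lambda>s. \<i> * complex_of_real s * f s)"
  by (rule sq_int_bounded_mult[where B = 1])
     (auto simp: norm_mult intro!: measurable_restrict_space1 borel_measurable_continuous_onI
        measurable_completion continuous_intros)

lemma sq_int_T: "sq_int f \<Longrightarrow> sq_int (\<lambda>s. exp (\<i> * complex_of_real s * complex_of_real t) * f s)"
  by (rule sq_int_bounded_mult[where B = 1])
     (auto simp: intro!: measurable_restrict_space1 borel_measurable_continuous_onI
        measurable_completion continuous_intros)

lift_definition A_fun :: "L2 \<Rightarrow> L2" is "\<lambda>f s. \<i> * complex_of_real s * f s"
  by (auto intro: sq_int_A)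

lift_definition T_fun :: "real \<Rightarrow> L2 \<Rightarrow> L2" is
    "\<lambda>t f s. exp (\<i> * complex_of_real s * complex_of_real t) * f s"
  by (auto intro: sq_int_T)

lift_definition C_fun :: "L2 \<Rightarrow> complex" is "\<lambda>f. \<integral>s. f s \<partial>leb01"
  by (auto intro!: integral_cong_AE sq_int_measurable)

lemma norm_L2_mono:
  assumes f: "sq_int f" and g: "sq_int g" and le: "\<And>s. 0 < s \<Longrightarrow> s < 1 \<Longrightarrow> cmod (f s) \<le> cmod (g s)"
  shows "sqrt (\<integral>s. (cmod (f s))\<^sup>2 \<partial>leb01) \<le> sqrt (\<integral>s. (cmod (g s))\<^sup>2 \<partial>leb01)"
  by (intro real_sqrt_le_mono integral_mono sq_int_integrable f g power_mono) (auto intro: le)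

lift_definition A_op :: "L2 \<Rightarrow>\<^sub>L L2" is A_fun
proof (rule bounded_linear_intro[where K = 1])
  fix x y :: L2 and r :: real
  show "A_fun (x + y) = A_fun x + A_fun y"
    by transfer (auto simp: distrib_left intro!: sq_int_add sq_int_A)
  show "A_fun (r *\<^sub>R x) = r *\<^sub>R A_fun x"
    by transfer (auto simp: mult.left_commute intro!: sq_int_cmult[OF sq_int_A]
        sq_int_A[OF sq_int_cmult])
  have "norm (A_fun x) \<le> norm x"
    by transfer (rule norm_L2_mono, auto simp: norm_mult intro!: sq_int_A mult_left_le_one_le)
  thus "norm (A_fun x) \<le> norm x * 1" by simp
qed

lift_definition T_op :: "real \<Rightarrow> L2 \<Rightarrow>\<^sub>L L2" is T_fun
proof (rule bounded_linear_intro[where K = 1])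
  fix t r :: real and x y :: L2
  show "T_fun t (x + y) = T_fun t x + T_fun t y"
    by transfer (auto simp: distrib_left intro!: sq_int_add sq_int_T)
  show "T_fun t (r *\<^sub>R x) = r *\<^sub>R T_fun t x"
    by transfer (auto simp: mult.left_commute intro!: sq_int_cmult[OF sq_int_T]
        sq_int_T[OF sq_int_cmult])
  have "norm (T_fun t x) \<le> norm x"
    by transfer (rule norm_L2_mono, auto simp: norm_mult intro!: sq_int_T)
  thus "norm (T_fun t x) \<le> norm x * 1" by simp
qed

lift_definition const_L2 :: "complex \<Rightarrow> L2" is "\<lambda>c s. c" by simp

lift_definition C_op :: "L2 \<Rightarrow>\<^sub>L complex" is C_fun
proof (rule bounded_linear_intro[where K = "norm (const_L2 1) + norm (const_L2 \<i>)"])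
  fix r :: real and x y :: L2
  show "C_fun (x + y) = C_fun x + C_fun y"
    by transfer (simp add: Bochner_Integration.integral_add sq_int_imp_integrable)
  show "C_fun (r *\<^sub>R x) = r *\<^sub>R C_fun x"
    by transfer (simp add: scaleR_conv_of_real)
  have Re: "Re (C_fun x) = inner x (const_L2 1)"
    by transfer simp
  have Im: "Im (C_fun x) = inner x (const_L2 \<i>)"
    by transfer simp
  have "norm (C_fun x) \<le> \<bar>Re (C_fun x)\<bar> + \<bar>Im (C_fun x)\<bar>"
    by (rule cmod_le)
  also have "\<dots> \<le> norm x * norm (const_L2 1) + norm x * norm (const_L2 \<i>)"
    unfolding Re Im by (intro add_mono Cauchy_Schwarz_ineq2)
  finally show "norm (C_fun x) \<le> norm x * (norm (const_L2 1) + norm (const_L2 \<i>))"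
    by (simp add: distrib_left)
qed

lemma A_op_scaleC: "A_op (scaleC_L2 c x) = scaleC_L2 c (A_op x)"
  unfolding A_op.rep_eq
  by transfer (auto simp: mult.left_commute intro!: sq_int_cmult[OF sq_int_A]
      sq_int_A[OF sq_int_cmult])

lemma T_op_scaleC: "T_op t (scaleC_L2 c x) = scaleC_L2 c (T_op t x)"
  unfolding T_op.rep_eq
  by transfer (auto simp: mult.left_commute intro!: sq_int_cmult[OF sq_int_T]
      sq_int_T[OF sq_int_cmult])

lemma C_op_scaleC: "C_op (scaleC_L2 c x) = c * C_op x"
  unfolding C_op.rep_eq by transfer simp

section \<open>Linear systems with output\<close>

definition C0_group :: "(real \<Rightarrow> 'a::real_normed_vector \<Rightarrow>\<^sub>L 'a) \<Rightarrow> bool" where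
  "C0_group T \<longleftrightarrow> T 0 = id_blinfun \<and> (\<forall>s t. T (s + t) = T s o\<^sub>L T t)
     \<and> (\<forall>x. continuous_on UNIV (\<lambda>t. T t x))"

text \<open>The generator is everywhere defined here, since only bounded generators occur.\<close>

definition generates_C0_group ::
    "('a::real_normed_vector \<Rightarrow>\<^sub>L 'a) \<Rightarrow> (real \<Rightarrow> 'a \<Rightarrow>\<^sub>L 'a) \<Rightarrow> bool" where
  "generates_C0_group A T \<longleftrightarrow> C0_group T
     \<and> (\<forall>x. ((\<lambda>h. (T h x - x) /\<^sub>R h) \<longlongrightarrow> A x) (at 0))"

definition mild_solution ::
    "(real \<Rightarrow> 'a::real_normed_vector \<Rightarrow>\<^sub>L 'a) \<Rightarrow> real \<Rightarrow> 'a \<Rightarrow> 'a" where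
  "mild_solution T t x = T t x"

definition output_traj :: "(real \<Rightarrow> 'a::real_normed_vector \<Rightarrow>\<^sub>L 'a) \<Rightarrow>
    ('a \<Rightarrow>\<^sub>L 'b::real_normed_vector) \<Rightarrow> real \<Rightarrow> 'a \<Rightarrow> 'b" where
  "output_traj T C t x = C (mild_solution T t x)"

definition class_K :: "(real \<Rightarrow> real) set" where
  "class_K = {\<gamma>. \<gamma> \<in> {0..} \<rightarrow> {0..} \<and> continuous_on {0..} \<gamma>
     \<and> strict_mono_on {0..} \<gamma> \<and> \<gamma> 0 = 0}"

definition exp_zero_detectable :: "(real \<Rightarrow> 'a::real_normed_vector \<Rightarrow>\<^sub>L 'a) \<Rightarrow>
    ('a \<Rightarrow>\<^sub>L 'b::real_normed_vector) \<Rightarrow> bool" where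
  "exp_zero_detectable T C \<longleftrightarrow> (\<exists>M>0. \<exists>\<omega>>0. \<forall>x.
     (\<forall>t\<ge>0. output_traj T C t x = 0) \<longrightarrow>
     (\<forall>t\<ge>0. norm (mild_solution T t x) \<le> M * exp (- \<omega> * t) * norm x))"

text \<open>The supremum below is a maximum: for a strongly continuous \<open>T\<close> the output is continuous
  on the compact interval \<open>[0,t]\<close>.\<close>

definition eOSS :: "(real \<Rightarrow> 'a::real_normed_vector \<Rightarrow>\<^sub>L 'a) \<Rightarrow>
    ('a \<Rightarrow>\<^sub>L 'b::real_normed_vector) \<Rightarrow> bool" where
  "eOSS T C \<longleftrightarrow> (\<exists>M>0. \<exists>\<mu>>0. \<exists>\<gamma>\<in>class_K. \<forall>x. \<forall>t\<ge>0.
     norm (mild_solution T t x) \<le> M * exp (- \<mu> * t) * norm x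
       + \<gamma> (SUP s\<in>{0..t}. norm (output_traj T C s x)))"

end

theory Submission
  imports Defs
begin

text \<open>
  Both \<open>A\<close> and \<open>T(t)\<close> multiply \<open>f\<close> by a function of \<open>s \<in> (0, 1)\<close>, so the pointwise bounds
  \<open>|exp (i s t) - 1| \<le> |t|\<close> and \<open>|exp (i s t) - 1 - i s t| \<le> t\<^sup>2\<close> show that \<open>T\<close> is
  strongly continuous with generator \<open>A\<close>. All operators \<open>T(t)\<close> are isometries. In particular no
  nonzero trajectory decays, and both detectability notions become statements about outputs.

  The output \<open>y(t, f)\<close> is the Fourier transform of \<open>f\<close>, and the states whose output
  vanishes for all \<open>t \<ge> 0\<close> form an \<open>A\<close>-invariant set, as differentiating the output shows
  (\<open>zero_output_generator\<close>). For such an \<open>f\<close> all \<open>C (A ^ n f)\<close> vanish, which says that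
  \<open>f\<close> has zero moments. By the Weierstrass theorem \<open>f = 0\<close>
  (\<open>vanishing_moments_imp_AE_0\<close>). Hence the system is zero-detectable in the strongest sense:
  only the zero state has zero output.

  There is however no quantitative version of this. The constant function \<open>1\<close> has output
  \<open>(exp (i t) - 1) / (i t)\<close>, which tends to \<open>0\<close> as \<open>t\<close> tends to minus infinity. Starting from
  \<open>T(\<tau>) 1\<close> with \<open>\<tau>\<close> very negative, that is from a rapidly oscillating exponential, the state keeps
  norm \<open>1\<close> while the output stays as small as desired on a prescribed interval \<open>[0, t]\<close>.
  This contradicts eOSS as soon as \<open>t\<close> is so large that the decaying term is at most half of
  the initial norm (\<open>isometric_not_eOSS\<close>).
\<close>

section \<open>Linear systems over a \<open>C\<^sub>0\<close>-group\<close>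

text \<open>Both sides are the derivative of \<open>T(t + h) x\<close> at \<open>h = 0\<close>, because this vector is
  \<open>T(h) (T(t) x)\<close> as well as \<open>T(t) (T(h) x)\<close>.\<close>

lemma generator_commutes_group:
  assumes "generates_C0_group A T"
  shows "A (T t x) = T t (A x)"
proof -
  have add: "T (a + b) = T a o\<^sub>L T b" for a b
    using assms by (simp add: generates_C0_group_def C0_group_def)
  have gen: "((\<lambda>h. (T h z - z) /\<^sub>R h) \<longlongrightarrow> A z) (at 0)" for z
    using assms by (simp add: generates_C0_group_def)
  have "T h (T t x) = T t (T h x)" for h
    using arg_cong[OF add.commute[of h t], of T] unfolding add
    by (metis blinfun_apply_blinfun_compose)
  hence "(T h (T t x) - T t x) /\<^sub>R h = T t ((T h x - x) /\<^sub>R h)" for h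
    by (simp add: blinfun.bilinear_simps)
  moreover have "((\<lambda>h. T t ((T h x - x) /\<^sub>R h)) \<longlongrightarrow> T t (A x)) (at 0)"
    by (intro blinfun.tendsto tendsto_const gen)
  ultimately have "((\<lambda>h. (T h (T t x) - T t x) /\<^sub>R h) \<longlongrightarrow> T t (A x)) (at 0)"
    by simp
  with gen[of "T t x"] show ?thesis
    by (rule tendsto_unique[rotated]) simp
qed

text \<open>The derivative of the zero output is zero, and it is the output of \<open>A x\<close>. At \<open>t = 0\<close> the
  output is known to vanish only to the right, so right derivatives are used throughout.\<close>

lemma zero_output_generator:
  assumes gen: "generates_C0_group A T"
    and zero: "\<And>t. t \<ge> 0 \<Longrightarrow> output_traj T C t x = 0" and t: "t \<ge> 0"
  shows "output_traj T C t (A x) = 0"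
proof -
  have add: "T (a + b) = T a o\<^sub>L T b" for a b
    using gen by (simp add: generates_C0_group_def C0_group_def)
  have "((\<lambda>h. (T h (T t x) - T t x) /\<^sub>R h) \<longlongrightarrow> A (T t x)) (at_right 0)"
    using gen unfolding generates_C0_group_def
    by (blast intro: filterlim_at_split[THEN iffD1, THEN conjunct2])
  hence "((\<lambda>h. C ((T h (T t x) - T t x) /\<^sub>R h)) \<longlongrightarrow> C (A (T t x))) (at_right 0)"
    by (intro blinfun.tendsto tendsto_const)
  moreover have "\<forall>\<^sub>F h in at_right 0. C ((T h (T t x) - T t x) /\<^sub>R h) = 0"
    unfolding eventually_at_filter
  proof (intro always_eventually allI impI)
    fix h :: real
    assume "h \<noteq> 0" "h \<in> {0<..}"
    hence "C (T (h + t) x) = 0" "C (T t x) = 0"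
      using zero[of "h + t"] zero[of t] t by (auto simp: output_traj_def mild_solution_def)
    thus "C ((T h (T t x) - T t x) /\<^sub>R h) = 0"
      by (simp add: add blinfun.bilinear_simps)
  qed
  ultimately have "((\<lambda>h::real. 0) \<longlongrightarrow> C (A (T t x))) (at_right 0)"
    using tendsto_cong by fastforce
  hence "C (A (T t x)) = 0"
    using tendsto_unique[OF _ _ tendsto_const] trivial_limit_at_right_real by blast
  thus ?thesis
    by (simp add: output_traj_def mild_solution_def generator_commutes_group[OF gen])
qed

lemma zero_output_powers:
  assumes gen: "generates_C0_group A T"
    and zero: "\<And>t. t \<ge> 0 \<Longrightarrow> output_traj T C t x = 0"
  shows "C ((blinfun_apply A ^^ n) x) = 0"
proof -
  have "output_traj T C t ((blinfun_apply A ^^ n) x) = 0" if "t \<ge> 0" for t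
    using that by (induction n arbitrary: t) (auto intro: zero zero_output_generator[OF gen])
  from this[of 0] show ?thesis
    using gen by (simp add: output_traj_def mild_solution_def generates_C0_group_def C0_group_def)
qed

text \<open>Moving \<open>x\<close> far backwards along its own orbit yields states of the same norm whose
  output is uniformly small on a given interval \<open>[0, t]\<close>. Since the trajectory keeps its
  norm, the estimate in eOSS cannot hold for them when \<open>t\<close> is large.\<close>

lemma isometric_not_eOSS:
  fixes T :: "real \<Rightarrow> 'a::real_normed_vector \<Rightarrow>\<^sub>L 'a" and C :: "'a \<Rightarrow>\<^sub>L 'b::real_normed_vector"
  assumes group: "C0_group T" and iso: "\<And>t x. norm (T t x) = norm x"
    and "x \<noteq> 0" and decay: "((\<lambda>t. C (T t x)) \<longlongrightarrow> 0) at_bot"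
  shows "\<not> eOSS T C"
proof
  assume "eOSS T C"
  then obtain M \<mu> \<gamma> where "\<mu> > 0" and \<gamma>: "\<gamma> \<in> class_K"
    and est: "\<And>z t. t \<ge> 0 \<Longrightarrow> norm (mild_solution T t z) \<le> M * exp (- \<mu> * t) * norm z
       + \<gamma> (SUP s\<in>{0..t}. norm (output_traj T C s z))"
    unfolding eOSS_def by blast
  have add: "T (a + b) = T a o\<^sub>L T b" for a b
    using group by (simp add: C0_group_def)
  \<comment> \<open>\<open>t\<close> and \<open>\<epsilon>\<close> are chosen such that each of the two terms on the right of the estimate
    is at most \<open>norm x / 2\<close>, the second one strictly.\<close>
  have "((\<lambda>t. M * exp (- \<mu> * t)) \<longlongrightarrow> M * 0) at_top"
    using \<open>\<mu> > 0\<close>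
    by (intro tendsto_intros filterlim_compose[OF exp_at_bot]
        filterlim_tendsto_neg_mult_at_bot[OF tendsto_const] filterlim_ident) auto
  hence "\<forall>\<^sub>F t in at_top. M * exp (- \<mu> * t) < 1/2"
    by (intro order_tendstoD(2)[where y = "M * 0"]) auto
  with eventually_ge_at_top[of 0]
  have "\<forall>\<^sub>F t in at_top. 0 \<le> t \<and> M * exp (- \<mu> * t) < 1/2"
    by (rule eventually_conj)
  then obtain t where t: "t \<ge> 0" "M * exp (- \<mu> * t) < 1/2"
    using eventually_happens' trivial_limit_at_top_linorder by blast
  have "(\<gamma> \<longlongrightarrow> \<gamma> 0) (at_right 0)"
  proof (rule tendsto_within_subset)
    show "(\<gamma> \<longlongrightarrow> \<gamma> 0) (at 0 within {0..})"
      using \<gamma> unfolding class_K_def continuous_on by blast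
  qed auto
  hence "\<forall>\<^sub>F \<epsilon> in at_right 0. \<gamma> \<epsilon> < norm x / 2"
    using \<gamma> \<open>x \<noteq> 0\<close> by (intro order_tendstoD(2)[where y = "\<gamma> 0"]) (auto simp: class_K_def)
  with eventually_at_right_less[of "0::real"]
  have "\<forall>\<^sub>F \<epsilon> in at_right 0. 0 < \<epsilon> \<and> \<gamma> \<epsilon> < norm x / 2"
    by (rule eventually_conj)
  then obtain \<epsilon> where \<epsilon>: "\<epsilon> > 0" "\<gamma> \<epsilon> < norm x / 2"
    using eventually_happens' trivial_limit_at_right_real by blast
  have "\<forall>\<^sub>F \<tau> in at_bot. norm (C (T \<tau> x)) < \<epsilon>"
    using tendstoD[OF decay \<epsilon>(1)] by simp
  then obtain \<tau> where \<tau>: "\<And>r. r \<le> \<tau> \<Longrightarrow> norm (C (T r x)) < \<epsilon>"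
    by (auto simp: eventually_at_bot_linorder)
  define z where "z = T (\<tau> - t) x"
  have out: "norm (output_traj T C s z) \<le> \<epsilon>" if "s \<in> {0..t}" for s
    using \<tau>[of "s + (\<tau> - t)"] that
    by (simp add: output_traj_def mild_solution_def z_def add)
  have "0 \<le> norm (output_traj T C 0 z)" by simp
  also have "\<dots> \<le> (SUP s\<in>{0..t}. norm (output_traj T C s z))"
    using t(1) by (intro cSUP_upper bdd_aboveI2[where M = \<epsilon>] out) auto
  finally have "0 \<le> (SUP s\<in>{0..t}. norm (output_traj T C s z))" .
  moreover have "(SUP s\<in>{0..t}. norm (output_traj T C s z)) \<le> \<epsilon>"
    using t(1) by (intro cSUP_least out) auto
  ultimately have "\<gamma> (SUP s\<in>{0..t}. norm (output_traj T C s z)) \<le> \<gamma> \<epsilon>"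
    using \<gamma> \<epsilon>(1) unfolding class_K_def
    by (auto intro!: strict_mono_on_leD[of "{0..}" \<gamma>])
  moreover have "M * exp (- \<mu> * t) * norm x \<le> 1/2 * norm x"
    using t(2) by (intro mult_right_mono) auto
  ultimately show False
    using est[OF t(1), of z] \<epsilon>(2) by (simp add: mild_solution_def iso z_def)
qed

section \<open>Vanishing moments\<close>

text \<open>The moments kill every polynomial, and polynomials are uniformly dense in the continuous
  functions on \<open>[0, 1]\<close>; as \<open>f\<close> is only integrable, the error is controlled by the uniform norm
  of the difference times the \<open>L\<^sup>1\<close>-norm \<open>I\<close> of \<open>f\<close>.\<close>

lemma integral_mult_continuous_eq_0:
  fixes f :: "real \<Rightarrow> complex" and g :: "real \<Rightarrow> real"
  assumes f: "integrable leb01 f"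
    and moments: "\<And>n. (\<integral>s. s ^ n *\<^sub>R f s \<partial>leb01) = 0"
    and g: "continuous_on {0..1} g"
  shows "(\<integral>s. g s *\<^sub>R f s \<partial>leb01) = 0"
proof -
  have gm: "g \<in> borel_measurable leb01"
    by (intro continuous_imp_measurable_on_sets_lebesgue continuous_on_subset[OF g]) auto
  have bdd: "integrable leb01 (\<lambda>s. h s *\<^sub>R f s)"
    if "h \<in> borel_measurable leb01" "\<And>s. s \<in> {0..1} \<Longrightarrow> \<bar>h s\<bar> \<le> B" for h :: "real \<Rightarrow> real" and B
    using f that
    by (intro Bochner_Integration.integrable_bound[OF integrable_scaleR_right[of B, OF f]] AE_I2)
       (auto intro!: mult_right_mono order.trans[OF _ abs_ge_self] borel_measurable_scaleR)
  have "norm (\<integral>s. g s *\<^sub>R f s \<partial>leb01) \<le> 0 + e" if e: "e > 0" for e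
  proof -
    define I where "I = (\<integral>s. norm (f s) \<partial>leb01)"
    have I: "I \<ge> 0" by (simp add: I_def)
    \<comment> \<open>The added \<open>1\<close> covers the case \<open>I = 0\<close>.\<close>
    obtain p where p: "real_polynomial_function p" "\<And>s. s \<in> {0..1} \<Longrightarrow> \<bar>g s - p s\<bar> < e / (I + 1)"
      by (rule Stone_Weierstrass_real_polynomial_function[OF compact_Icc g, of "e / (I + 1)"])
         (use e I in \<open>auto intro: divide_pos_pos\<close>)
    then obtain a n where p_eq: "p = (\<lambda>s. \<Sum>i\<le>n. a i * s ^ i)"
      using real_polynomial_function_iff_sum by auto
    have pow: "integrable leb01 (\<lambda>s. s ^ i *\<^sub>R f s)" for i
      by (rule bdd[where B = 1]) (auto simp: power_abs intro!: power_le_one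
          continuous_imp_measurable_on_sets_lebesgue continuous_intros)
    have pf: "p s *\<^sub>R f s = (\<Sum>i\<le>n. a i *\<^sub>R (s ^ i *\<^sub>R f s))" for s
      by (simp add: p_eq scaleR_sum_left)
    have "(\<integral>s. p s *\<^sub>R f s \<partial>leb01) = (\<Sum>i\<le>n. a i *\<^sub>R (\<integral>s. s ^ i *\<^sub>R f s \<partial>leb01))"
      unfolding pf by (simp only: Bochner_Integration.integral_sum integral_scaleR_right
          integrable_scaleR_right pow)
    also have "\<dots> = 0"
      by (simp add: moments)
    finally have p0: "(\<integral>s. p s *\<^sub>R f s \<partial>leb01) = 0" .
    have pm: "p \<in> borel_measurable leb01"
      unfolding p_eq by (intro continuous_imp_measurable_on_sets_lebesgue continuous_intros) simp
    have ip: "integrable leb01 (\<lambda>s. p s *\<^sub>R f s)"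
      unfolding pf by (intro Bochner_Integration.integrable_sum integrable_scaleR_right pow)
    have id: "integrable leb01 (\<lambda>s. (g s - p s) *\<^sub>R f s)"
      using p(2) gm pm by (intro bdd[where B = "e / (I + 1)"]) (auto intro: less_imp_le)
    have "(\<integral>s. g s *\<^sub>R f s \<partial>leb01) = (\<integral>s. (g s - p s) *\<^sub>R f s + p s *\<^sub>R f s \<partial>leb01)"
      by (simp flip: scaleR_add_left)
    also have "\<dots> = (\<integral>s. (g s - p s) *\<^sub>R f s \<partial>leb01)"
      using id ip by (simp add: p0)
    also have "norm \<dots> \<le> (\<integral>s. e / (I + 1) * norm (f s) \<partial>leb01)"
    proof (rule Bochner_Integration.integral_norm_bound_integral)
      show "norm ((g s - p s) *\<^sub>R f s) \<le> e / (I + 1) * norm (f s)" if "s \<in> space leb01" for s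
        using that p(2)[of s] unfolding norm_scaleR by (intro mult_right_mono) auto
    qed (use f id in auto)
    also have "\<dots> = e * (I / (I + 1))"
      by (simp add: I_def)
    also have "\<dots> \<le> e"
      using e I by (intro mult_left_le) auto
    finally show ?thesis by simp
  qed
  hence "norm (\<integral>s. g s *\<^sub>R f s \<partial>leb01) \<le> 0"
    by (rule field_le_epsilon)
  thus ?thesis by simp
qed

text \<open>It is enough that \<open>f\<close> has integral \<open>0\<close> over every measurable set \<open>E\<close>. The indicator of
  \<open>E\<close> is almost everywhere the limit of continuous functions, and truncating these to \<open>[0, 1]\<close>
  makes \<open>norm (f s)\<close> a dominating function, so that the claim for \<open>E\<close> follows from the one for
  continuous functions.\<close>

lemma vanishing_moments_imp_AE_0:
  fixes f :: "real \<Rightarrow> complex"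
  assumes f: "integrable leb01 f"
    and moments: "\<And>n. (\<integral>s. s ^ n *\<^sub>R f s \<partial>leb01) = 0"
  shows "AE s in leb01. f s = 0"
proof (rule sigma_finite_measure.density_zero[OF _ f])
  show "sigma_finite_measure leb01"
    by (intro finite_measure.axioms(1) finite_measure_lebesgue_on) simp
next
  fix E assume E: "E \<in> sets leb01"
  hence "E \<in> sets lebesgue"
    by (simp add: sets_restrict_space_iff)
  from indicator_measurable_on[OF this] obtain N g
    where N: "negligible N" and g: "\<And>n. continuous_on UNIV (g n :: real \<Rightarrow> real)"
      and lim: "\<And>s. s \<notin> N \<Longrightarrow> (\<lambda>n. g n s) \<longlonglongrightarrow> indicat_real E s"
    unfolding measurable_on_def by auto
  define h where "h n s = max 0 (min 1 (g n s))" for n s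
  have h: "continuous_on UNIV (h n)" for n
    unfolding h_def by (intro continuous_intros g)
  have hm: "h n \<in> borel_measurable leb01" for n
    by (intro continuous_imp_measurable_on_sets_lebesgue continuous_on_subset[OF h]) auto
  have "AE s in leb01. s \<notin> N"
    using N by (intro AE_restrict_space_iff[THEN iffD2]) 
      (auto simp: negligible_iff_null_sets intro: AE_not_in AE_mp)
  hence "(\<lambda>n. \<integral>s. h n s *\<^sub>R f s \<partial>leb01) \<longlonglongrightarrow> (\<integral>s. indicat_real E s *\<^sub>R f s \<partial>leb01)"
  proof (intro integral_dominated_convergence[where w = "\<lambda>s. norm (f s)"])
    show "AE s in leb01. (\<lambda>n. h n s *\<^sub>R f s) \<longlonglongrightarrow> indicat_real E s *\<^sub>R f s"
      using \<open>AE s in leb01. s \<notin> N\<close>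
    proof eventually_elim
      case (elim s)
      have "(\<lambda>n. h n s) \<longlonglongrightarrow> max 0 (min 1 (indicat_real E s))"
        unfolding h_def by (intro tendsto_intros lim elim)
      also have "max 0 (min 1 (indicat_real E s)) = indicat_real E s"
        by (simp add: indicator_def)
      finally show ?case by (intro tendsto_intros)
    qed
    show "AE s in leb01. norm (h n s *\<^sub>R f s) \<le> norm (f s)" for n
      by (rule AE_I2) (auto simp: h_def intro!: mult_left_le_one_le)
  qed (use f E hm in auto)
  moreover have "(\<integral>s. h n s *\<^sub>R f s \<partial>leb01) = 0" for n
    by (rule integral_mult_continuous_eq_0[OF f moments continuous_on_subset[OF h]]) simp
  ultimately show "set_lebesgue_integral leb01 E f = 0"
    unfolding set_lebesgue_integral_def by (simp add: LIMSEQ_const_iff)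
qed

section \<open>The multiplication group on \<open>L\<^sup>2(0,1)\<close>\<close>

lemma L2_representative:
  obtains f where "sq_int f" "x = abs_L2 f"
  using that by (induct x rule: L2.abs_induct) auto

text \<open>Operator bounds on \<open>L\<^sup>2(0,1)\<close> reduce through this to pointwise bounds on multipliers.\<close>

lemma norm_L2_le_pointwise:
  assumes f: "sq_int f" and g: "sq_int g" and "K \<ge> 0"
    and le: "\<And>s. 0 < s \<Longrightarrow> s < 1 \<Longrightarrow> cmod (f s) \<le> K * cmod (g s)"
  shows "norm (abs_L2 f) \<le> K * norm (abs_L2 g)"
proof -
  have "norm (abs_L2 f) \<le> norm (abs_L2 (\<lambda>s. complex_of_real K * g s))"
    unfolding norm_L2.abs_eq[of f, simplified, OF f]
      norm_L2.abs_eq[of "\<lambda>s. complex_of_real K * g s", simplified, OF sq_int_cmult[OF g]]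
    using le \<open>K \<ge> 0\<close> by (intro norm_L2_mono f sq_int_cmult g) (simp add: norm_mult)
  also have "abs_L2 (\<lambda>s. complex_of_real K * g s) = K *\<^sub>R abs_L2 g"
    using g by (simp add: scaleR_L2.abs_eq)
  finally show ?thesis using \<open>K \<ge> 0\<close> by simp
qed

lemma norm_T_op [simp]: "norm (T_op t x) = norm x"
  unfolding T_op.rep_eq by transfer (simp add: norm_mult)

lemma T_op_0: "T_op 0 x = x"
  unfolding T_op.rep_eq by transfer auto

lemma T_op_add: "T_op (s + t) x = T_op s (T_op t x)"
proof -
  obtain f where f: "sq_int f" "x = abs_L2 f" by (rule L2_representative)
  show ?thesis
    using f(1) sq_int_T[OF sq_int_T[OF f(1)], of s t]
    by (simp add: f(2) T_op.rep_eq T_fun.abs_eq sq_int_T) (simp add: distrib_left exp_add mult.assoc)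
qed

lemma T_op_diff_le: "norm (T_op h x - x) \<le> \<bar>h\<bar> * norm x"
proof -
  obtain f where f: "sq_int f" "x = abs_L2 f" by (rule L2_representative)
  have *: "cmod (exp (\<i> * of_real s * of_real h) - 1) \<le> \<bar>h\<bar>" if "0 < s" "s < 1" for s
  proof -
    have "cmod (exp (\<i> * of_real s * of_real h) - 1) \<le> \<bar>s\<bar> * \<bar>h\<bar>"
      using Taylor_exp[of "\<i> * of_real s * of_real h" 0] by (simp add: norm_mult)
    also have "\<dots> \<le> \<bar>h\<bar>" using that by (simp add: mult_left_le_one_le)
    finally show ?thesis .
  qed
  have "T_op h x - x = abs_L2 (\<lambda>s. exp (\<i> * of_real s * of_real h) * f s - f s)"
    using f(1) by (simp add: f(2) T_op.rep_eq T_fun.abs_eq minus_L2.abs_eq sq_int_T)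
  also have "norm \<dots> \<le> \<bar>h\<bar> * norm (abs_L2 f)"
  proof (rule norm_L2_le_pointwise)
    show "cmod (exp (\<i> * of_real s * of_real h) * f s - f s) \<le> \<bar>h\<bar> * cmod (f s)"
      if "0 < s" "s < 1" for s
      using mult_right_mono[OF *[OF that], of "cmod (f s)"]
      by (simp add: algebra_simps flip: norm_mult)
  qed (use f(1) in \<open>auto intro: sq_int_diff sq_int_T\<close>)
  finally show ?thesis by (simp add: f(2))
qed

lemma T_op_taylor_le: "norm (T_op h x - x - h *\<^sub>R A_op x) \<le> h\<^sup>2 * norm x"
proof -
  obtain f where f: "sq_int f" "x = abs_L2 f" by (rule L2_representative)
  have *: "cmod (exp (\<i> * of_real s * of_real h) - 1 - \<i> * of_real s * of_real h) \<le> h\<^sup>2"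
    if "0 < s" "s < 1" for s
  proof -
    have "cmod (exp (\<i> * of_real s * of_real h) - 1 - \<i> * of_real s * of_real h) \<le> (\<bar>s\<bar> * \<bar>h\<bar>)\<^sup>2"
      using Taylor_exp[of "\<i> * of_real s * of_real h" 1] by (simp add: norm_mult diff_diff_eq power2_eq_square)
    also have "\<dots> \<le> \<bar>h\<bar>\<^sup>2" using that by (intro power_mono) (auto simp: mult_left_le_one_le)
    finally show ?thesis by simp
  qed
  have "T_op h x - x - h *\<^sub>R A_op x =
      abs_L2 (\<lambda>s. exp (\<i> * of_real s * of_real h) * f s - f s - of_real h * (\<i> * of_real s * f s))"
    using f(1) by (simp add: f(2) T_op.rep_eq A_op.rep_eq T_fun.abs_eq A_fun.abs_eq minus_L2.abs_eq
        scaleR_L2.abs_eq sq_int_T sq_int_A sq_int_diff sq_int_cmult)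
  also have "norm \<dots> \<le> h\<^sup>2 * norm (abs_L2 f)"
  proof (rule norm_L2_le_pointwise)
    show "cmod (exp (\<i> * of_real s * of_real h) * f s - f s - of_real h * (\<i> * of_real s * f s))
        \<le> h\<^sup>2 * cmod (f s)" if "0 < s" "s < 1" for s
      using mult_right_mono[OF *[OF that], of "cmod (f s)"]
      by (simp add: algebra_simps flip: norm_mult)
  qed (use f(1) in \<open>auto intro!: sq_int_diff sq_int_T sq_int_A sq_int_cmult[OF sq_int_A]\<close>)
  finally show ?thesis by (simp add: f(2))
qed

lemma C0_group_T_op: "C0_group T_op"
  unfolding C0_group_def
proof (intro conjI allI)
  show "T_op 0 = id_blinfun"
    by (rule blinfun_eqI) (simp add: T_op_0)
  show "T_op (s + t) = T_op s o\<^sub>L T_op t" for s t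
    by (rule blinfun_eqI) (simp add: T_op_add)
  show "continuous_on UNIV (\<lambda>t. T_op t x)" for x
  proof (rule lipschitz_on_continuous_on[of "norm x"], rule lipschitz_onI)
    fix s t :: real
    have "T_op s x - T_op t x = T_op t (T_op (s - t) x - x)"
      by (simp add: blinfun.bilinear_simps flip: T_op_add)
    thus "dist (T_op s x) (T_op t x) \<le> norm x * dist s t"
      using T_op_diff_le[of "s - t" x] by (simp add: dist_norm mult.commute)
  qed simp
qed

lemma generates_C0_group_A_op: "generates_C0_group A_op T_op"
  unfolding generates_C0_group_def
proof (intro conjI allI C0_group_T_op)
  fix x
  have "((\<lambda>h. (T_op h x - x) /\<^sub>R h - A_op x) \<longlongrightarrow> 0) (at 0)"
  proof (rule Lim_null_comparison)
    show "\<forall>\<^sub>F h in at 0. norm ((T_op h x - x) /\<^sub>R h - A_op x) \<le> \<bar>h\<bar> * norm x"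
      unfolding eventually_at_filter
    proof (intro always_eventually allI impI)
      fix h :: real assume "h \<noteq> 0"
      hence "(T_op h x - x) /\<^sub>R h - A_op x = (T_op h x - x - h *\<^sub>R A_op x) /\<^sub>R h"
        by (simp add: scaleR_diff_right)
      hence "norm ((T_op h x - x) /\<^sub>R h - A_op x) = norm (T_op h x - x - h *\<^sub>R A_op x) / \<bar>h\<bar>"
        by (simp add: divide_inverse_commute)
      also have "\<dots> \<le> h\<^sup>2 * norm x / \<bar>h\<bar>"
        by (intro divide_right_mono T_op_taylor_le) simp
      also have "\<dots> = \<bar>h\<bar> * norm x"
        using \<open>h \<noteq> 0\<close> by (cases "h > 0") (auto simp: power2_eq_square)
      finally show "norm ((T_op h x - x) /\<^sub>R h - A_op x) \<le> \<bar>h\<bar> * norm x" .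
    qed
    show "((\<lambda>h. \<bar>h\<bar> * norm x) \<longlongrightarrow> 0) (at 0)"
      by (auto intro!: tendsto_eq_intros)
  qed
  thus "((\<lambda>h. (T_op h x - x) /\<^sub>R h) \<longlongrightarrow> A_op x) (at 0)"
    by (simp add: LIM_zero_iff)
qed

lemma A_op_powers:
  assumes "sq_int f"
  shows "sq_int (\<lambda>s. (\<i> * of_real s) ^ n * f s)
    \<and> (blinfun_apply A_op ^^ n) (abs_L2 f) = abs_L2 (\<lambda>s. (\<i> * of_real s) ^ n * f s)"
proof (induction n)
  case (Suc n)
  hence s: "sq_int (\<lambda>s. (\<i> * of_real s) ^ n * f s)" by simp
  from sq_int_A[OF s] Suc show ?case
    by (simp add: A_op.rep_eq A_fun.abs_eq mult.assoc)
qed (use assms in simp)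

text \<open>Applying \<open>C\<close> to \<open>A ^ n x\<close> yields the \<open>n\<close>-th moment of \<open>x\<close> up to the factor \<open>\<i> ^ n\<close>.\<close>

lemma zero_output_imp_0:
  assumes "\<And>t. t \<ge> 0 \<Longrightarrow> output_traj T_op C_op t x = 0"
  shows "x = 0"
proof -
  obtain f where f: "sq_int f" "x = abs_L2 f" by (rule L2_representative)
  have "(\<integral>s. s ^ n *\<^sub>R f s \<partial>leb01) = 0" for n
  proof -
    have "0 = C_op ((blinfun_apply A_op ^^ n) x)"
      using zero_output_powers[OF generates_C0_group_A_op assms] by simp
    also have "\<dots> = (\<integral>s. (\<i> * of_real s) ^ n * f s \<partial>leb01)"
      using A_op_powers[OF f(1), of n] by (simp add: f(2) C_op.rep_eq C_fun.abs_eq)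
    also have "\<dots> = (\<integral>s. \<i> ^ n * (s ^ n *\<^sub>R f s) \<partial>leb01)"
      by (simp add: power_mult_distrib scaleR_conv_of_real mult.assoc)
    also have "\<dots> = \<i> ^ n * (\<integral>s. s ^ n *\<^sub>R f s \<partial>leb01)"
      by (rule integral_mult_right_zero)
    finally show ?thesis by simp
  qed
  hence "AE s in leb01. f s = 0"
    by (rule vanishing_moments_imp_AE_0[OF sq_int_imp_integrable[OF f(1)]])
  hence "abs_L2 f = abs_L2 (\<lambda>_. 0)"
    using f(1) by (intro Quotient_rel_abs[OF Quotient_L2]) simp
  thus ?thesis by (simp add: f(2) zero_L2_def)
qed

lemma output_const_L2:
  assumes "t \<noteq> 0"
  shows "C_op (T_op t (const_L2 1)) = (exp (\<i> * of_real t) - 1) / (\<i> * of_real t)"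
proof -
  define e where "e s = exp (\<i> * of_real s * of_real t)" for s :: real
  have e: "sq_int e"
    using sq_int_T[OF sq_int_const[of 1], of t] unfolding e_def by simp
  have "(e has_integral (e 1 / (\<i> * of_real t) - e 0 / (\<i> * of_real t))) {0..1}"
  proof (rule fundamental_theorem_of_calculus)
    show "((\<lambda>s. e s / (\<i> * of_real t)) has_vector_derivative e s) (at s within {0..1})" for s
      unfolding e_def using \<open>t \<noteq> 0\<close>
      by (auto intro!: derivative_eq_intros has_vector_derivative_real_field simp: field_simps)
  qed simp
  hence "integral {0<..<1} e = (exp (\<i> * of_real t) - 1) / (\<i> * of_real t)"
    by (simp add: has_integral_Icc_iff_Ioo integral_unique e_def diff_divide_distrib)
  moreover have "(\<integral>s. e s \<partial>leb01) = integral {0<..<1} e"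
    by (intro lebesgue_integral_eq_integral sq_int_imp_integrable e) simp
  moreover have "C_op (T_op t (const_L2 1)) = (\<integral>s. e s \<partial>leb01)"
    using e unfolding e_def
    by (simp add: C_op.rep_eq T_op.rep_eq const_L2.abs_eq T_fun.abs_eq C_fun.abs_eq)
  ultimately show ?thesis by simp
qed

lemma output_const_L2_tendsto_0: "((\<lambda>t. C_op (T_op t (const_L2 1))) \<longlongrightarrow> 0) at_bot"
proof (rule Lim_null_comparison)
  show "\<forall>\<^sub>F t in at_bot. norm (C_op (T_op t (const_L2 1))) \<le> - 2 * inverse t"
    using eventually_gt_at_bot[of 0]
  proof eventually_elim
    case (elim t)
    have "cmod (exp (\<i> * of_real t) - 1) \<le> 2"
      using norm_triangle_ineq4[of "exp (\<i> * of_real t)" 1] by simp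
    with elim show ?case
      by (simp add: output_const_L2 norm_divide norm_mult field_simps)
  qed
  have "(inverse \<longlongrightarrow> (0::real)) at_bot"
    by (rule tendsto_mono[OF at_bot_le_at_infinity tendsto_inverse_0])
  thus "((\<lambda>t::real. - 2 * inverse t) \<longlongrightarrow> 0) at_bot"
    by (rule tendsto_mult_right_zero)
qed

lemma const_L2_1_neq_0: "const_L2 1 \<noteq> 0"
proof -
  have "norm (const_L2 1) = 1"
    by transfer (simp add: measure_restrict_space)
  thus ?thesis by auto
qed

theorem proposition5p1:
  shows "generates_C0_group A_op T_op
    \<and> exp_zero_detectable T_op C_op
    \<and> \<not> eOSS T_op C_op"
proof (intro conjI)
  show "generates_C0_group A_op T_op"
    by (rule generates_C0_group_A_op)
  show "exp_zero_detectable T_op C_op"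
    unfolding exp_zero_detectable_def
  proof (intro exI[of _ 1] conjI allI impI)
    fix x t
    assume "\<forall>t\<ge>0. output_traj T_op C_op t x = 0"
    hence "x = 0" by (intro zero_output_imp_0) simp
    thus "norm (mild_solution T_op t x) \<le> 1 * exp (- 1 * t) * norm x"
      by (simp add: mild_solution_def)
  qed simp_all
  show "\<not> eOSS T_op C_op"
    by (rule isometric_not_eOSS[OF C0_group_T_op norm_T_op const_L2_1_neq_0 output_const_L2_tendsto_0])
qed

end
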